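(* Let $\mathcal{F}=(K_0\subset K_1\subset\cdots\subset K_N)$ be a filtration of finite simplicial complexes, and write $K=K_N$. Let $p\in\{0,1\}$, and let $b=(s,t;1)\in\mathbf{B}_p(\mathcal{F})$ be a generic bar. Let $z_0=\sum_{\sigma\in K^{[p]}}c_\sigma\cdot\sigma$ be a harmonic representative of $b$. Then for every $\sigma\in\Sigma(b)$ and every $\tau\in K^{[p]}$ with $\tau\neq\sigma$, $$|c_\tau|\le|c_\sigma|,$$ with equality if and only if $\tau\in\Sigma(b)$.
   Context: **Chains.** A finite simplicial complex $K$ is a (possibly empty) set of subsets of a finite set $\{0,\dots,m\}$, closed under passing to subsets. $K^{[p]}$ is the set of $p$-dimensional simplices $[i_0,\dots,i_p]$, $i_0<\cdots<i_p$. $C_p(K)$ is the real vector space with basis $K^{[p]}$, with $\partial_p[i_0,\dots,i_p]=\sum_j(-1)^j[i_0,\dots,\widehat{i_j},\dots,i_p]$ (and $\partial_0=0$). $Z_p(K)=\ker\partial_p$, $B_p(K)=\operatorname{Im}\partial_{p+1}$, $\mathrm{H}_p(K)=Z_p(K)/B_p(K)$ (real, unreduced), and $\phi_p(K):Z_p(K)\to \mathrm{H}_p(K)$ is the quotient map. $C_p(K)$ carries the inner product $\langle\cdot,\cdot\rangle$ for which $K^{[p]}$ is orthonormal; for a subcomplex $L\subset K$ we regard $C_p(L)\subset C_p(K)$. The harmonic homology subspace is $\mathcal{H}_p(K)=Z_p(K)\cap B_p(K)^\perp$. The support of $z=\sum c_\sigma\sigma$ is $\operatorname{supp}(z)=\{\sigma: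 c_\sigma\ne0\}$. **Persistence.** Let $T=\{0,\dots,N\}$ and let $\mathcal{F}=(K_t)_{t\in T}$ be a filtration with $K_N=K$; set $K_{-1}=\emptyset$. For $s\le t$, $i_p^{s,t}:\mathrm{H}_p(K_s)\to \mathrm{H}_p(K_t)$ is induced by inclusion and $\mathrm{H}_p^{s,t}(\mathcal{F})=\operatorname{Im}(i_p^{s,t})$. For $s\le t$ in $T$ let $M_p^{s,t}(\mathcal{F})=(i_p^{s,t})^{-1}(\mathrm{H}_p^{s-1,t}(\mathcal{F}))\subset \mathrm{H}_p(K_s)$. For $s<t$ in $T$ let $P_p^{s,t}(\mathcal{F})=M_p^{s,t}(\mathcal{F})/M_p^{s,t-1}(\mathcal{F})$, and let $P_p^{s,\infty}(\mathcal{F})=\mathrm{H}_p(K_s)/M_p^{s,N}(\mathcal{F})$. Put $\mu_p^{s,t}(\mathcal{F})=\dim P_p^{s,t}(\mathcal{F})$ for $s\in T$, $t\in T\cup\{\infty\}$, $s<t$. The barcode is $\mathbf{B}_p(\mathcal{F})=\{(s,t;\mu_p^{s,t}(\mathcal{F})):\mu_p^{s,t}(\mathcal{F})>0\}$; its elements are called bars. A bar is simple if $\mu_p^{s,t}(\mathcal{F})=1$. It is generic if it is simple and $\mu_p^{s,t'}(\mathcal{F})=0$ for every $t'\in T\cup\{\infty\}$ with $t'>s$, $t'\ne t$. **Harmonic representatives.** For $s\le t$, let $\mathfrak{i}_p^{s,t}:\mathcal{H}_p(K_s)\to\mathcal{H}_p(K_t)$ be the restriction to $\mathcal{H}_p(K_s)$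 of orthogonal projection onto $B_p(K_t)^\perp$, and $\mathcal{H}_p^{s,t}(\mathcal{F})=\operatorname{Im}\mathfrak{i}_p^{s,t}$. Let $\mathcal{M}_p^{s,t}(\mathcal{F})=(\mathfrak{i}_p^{s,t})^{-1}(\mathcal{H}_p^{s-1,t}(\mathcal{F}))$ for $s\le t$, $\mathcal{P}_p^{s,t}(\mathcal{F})=\mathcal{M}_p^{s,t}(\mathcal{F})\cap\mathcal{M}_p^{s,t-1}(\mathcal{F})^\perp$ for $s<t\le N$, and $\mathcal{P}_p^{s,\infty}(\mathcal{F})=\mathcal{H}_p(K_s)\cap\mathcal{M}_p^{s,N}(\mathcal{F})^\perp$. A harmonic representative of a simple bar $b=(s,t;1)$ is any nonzero element of $\mathcal{P}_p^{s,t}(\mathcal{F})$ (an element of $C_p(K_s)\subset C_p(K)$). **Essential simplices.** Let $\widetilde{M}_p^{s,t}(\mathcal{F})=\phi_p(K_s)^{-1}(M_p^{s,t}(\mathcal{F}))\subset Z_p(K_s)$. For a simple bar $b=(s,t;1)$, $\mathrm{Rep}(b)=\widetilde{M}_p^{s,t}(\mathcal{F})\setminus\widetilde{M}_p^{s,t-1}(\mathcal{F})$ if $t\neq\infty$, and $\mathrm{Rep}(b)=Z_p(K_s)\setminus\widetilde{M}_p^{s,N}(\mathcal{F})$ if $t=\infty$. The set of essential simplices of $b$ is $\Sigma(b)=\bigcap_{z\in\mathrm{Rep}(b)}\operatorname{supp}(z)$. *)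

theory Defs
  imports "HOL-Analysis.Analysis" "HOL-Algebra.AbelCoset" "HOL-Algebra.Module" "HOL-Library.Extended_Nat"
begin

text \<open>
  The vertex set \<open>{0,\<dots>,m}\<close> is an arbitrary finite linearly ordered type \<open>'v\<close>. Chains in all dimensions
  live in the Euclidean space \<open>real ^ 'v set\<close>, whose standard basis vector \<open>axis \<sigma> 1\<close> is the oriented
  simplex \<open>\<sigma>\<close>; this basis is orthonormal, so the inner product on chains is the standard one.
\<close>

section \<open>Real vector spaces with explicit carrier, quotients and dimension\<close>

text \<open>
  Homology and its subquotients are \<^const>\<open>module\<close> records over \<open>real\<close>, with the real scalars
  as a plain type. The ring multiplication and unit that such a record inherits are never used.
\<close>

definition lin_space :: "'a::real_vector set \<Rightarrow> (real, 'a) module" where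
  "lin_space S = \<lparr>carrier = S, monoid.mult = undefined, one = undefined, zero = 0,
     add = (+), smult = (*\<^sub>R)\<rparr>"

definition quotient_space :: "(real, 'a) module \<Rightarrow> 'a set \<Rightarrow> (real, 'a set) module" where
  "quotient_space V W = \<lparr>carrier = a_rcosets\<^bsub>V\<^esub> W, monoid.mult = undefined, one = undefined, zero = W,
     add = set_add V, smult = (\<lambda>r X. \<Union>x\<in>X. W +>\<^bsub>V\<^esub> (r \<odot>\<^bsub>V\<^esub> x))\<rparr>"

definition is_basis :: "(real, 'a) module \<Rightarrow> 'a set \<Rightarrow> bool" where
  "is_basis V S \<longleftrightarrow> finite S \<and> S \<subseteq> carrier V \<and>
     (\<forall>v\<in>carrier V. \<exists>!c. c \<in> extensional S \<and> v = (\<Oplus>\<^bsub>V\<^esub>x\<in>S. c x \<odot>\<^bsub>V\<^esub> x))"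

definition vdim :: "(real, 'a) module \<Rightarrow> nat" where
  "vdim V = (if \<exists>S. is_basis V S then card (SOME S. is_basis V S) else 0)"

section \<open>Simplicial complexes and chains\<close>

type_synonym 'v chain = "real ^ 'v set"

definition simplicial_complex :: "'v set set \<Rightarrow> bool" where
  "simplicial_complex K \<longleftrightarrow> (\<forall>\<sigma>\<in>K. \<forall>\<tau>\<subseteq>\<sigma>. \<tau> \<in> K)"

definition simplices :: "nat \<Rightarrow> 'v set set \<Rightarrow> 'v set set" where
  "simplices p K = {\<sigma>\<in>K. card \<sigma> = Suc p}"

definition supp :: "'v::finite chain \<Rightarrow> 'v set set" where
  "supp z = {\<sigma>. z $ \<sigma> \<noteq> 0}"

definition chains :: "nat \<Rightarrow> 'v::finite set set \<Rightarrow> 'v chain set" where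
  "chains p K = {z. supp z \<subseteq> simplices p K}"

definition boundary_simplex :: "'v::{finite,linorder} set \<Rightarrow> 'v chain" where
  "boundary_simplex \<sigma> =
     (\<Sum>j<card \<sigma>. (-1) ^ j *\<^sub>R axis (\<sigma> - {sorted_list_of_set \<sigma> ! j}) 1)"

text \<open>Homology is unreduced: the \<open>0\<close>-th boundary map vanishes.\<close>

definition boundary :: "nat \<Rightarrow> 'v::{finite,linorder} chain \<Rightarrow> 'v chain" where
  "boundary p z = (if p = 0 then 0 else \<Sum>\<sigma> | card \<sigma> = Suc p. (z $ \<sigma>) *\<^sub>R boundary_simplex \<sigma>)"

definition cycles :: "nat \<Rightarrow> 'v::{finite,linorder} set set \<Rightarrow> 'v chain set" where
  "cycles p K = {z\<in>chains p K. boundary p z = 0}"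

definition boundaries :: "nat \<Rightarrow> 'v::{finite,linorder} set set \<Rightarrow> 'v chain set" where
  "boundaries p K = boundary (Suc p) ` chains (Suc p) K"

definition homology :: "nat \<Rightarrow> 'v::{finite,linorder} set set \<Rightarrow> (real, 'v chain set) module" where
  "homology p K = quotient_space (lin_space (cycles p K)) (boundaries p K)"

definition homology_class :: "nat \<Rightarrow> 'v::{finite,linorder} set set \<Rightarrow> 'v chain \<Rightarrow> 'v chain set" where
  "homology_class p K z = boundaries p K +>\<^bsub>lin_space (cycles p K)\<^esub> z"

text \<open>
  The map into \<open>homology p L\<close> induced by an inclusion \<open>K \<subseteq> L\<close>. The classes in the union coincide when
  \<open>X\<close> is a homology class of \<open>K\<close>.
\<close>

definition induced_map :: "nat \<Rightarrow> 'v::{finite,linorder} set set \<Rightarrow> 'v chain set \<Rightarrow> 'v chain set" where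
  "induced_map p L X = (\<Union>z\<in>X. homology_class p L z)"

section \<open>Filtrations and persistent homology\<close>

definition filtration :: "nat \<Rightarrow> (nat \<Rightarrow> 'v set set) \<Rightarrow> bool" where
  "filtration N F \<longleftrightarrow> (\<forall>t\<le>N. simplicial_complex (F t)) \<and> (\<forall>t<N. F t \<subseteq> F (Suc t))"

text \<open>The complex of index \<open>s - 1\<close>, with the convention that the complex of index \<open>-1\<close> is empty.\<close>

definition before :: "(nat \<Rightarrow> 'v set set) \<Rightarrow> nat \<Rightarrow> 'v set set" where
  "before F s = (if s = 0 then {} else F (s - 1))"

definition M_sub ::
  "nat \<Rightarrow> (nat \<Rightarrow> 'v::{finite,linorder} set set) \<Rightarrow> nat \<Rightarrow> nat \<Rightarrow> 'v chain set set" where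
  "M_sub p F s t = {X \<in> carrier (homology p (F s)).
     induced_map p (F t) X \<in> induced_map p (F t) ` carrier (homology p (before F s))}"

definition P_space ::
  "nat \<Rightarrow> nat \<Rightarrow> (nat \<Rightarrow> 'v::{finite,linorder} set set) \<Rightarrow> nat \<Rightarrow> enat
     \<Rightarrow> (real, 'v chain set set) module" where
  "P_space p N F s t = (case t of
     enat u \<Rightarrow> quotient_space (homology p (F s)\<lparr>carrier := M_sub p F s u\<rparr>) (M_sub p F s (u - 1))
   | \<infinity> \<Rightarrow> quotient_space (homology p (F s)) (M_sub p F s N))"

definition bar_mult ::
  "nat \<Rightarrow> nat \<Rightarrow> (nat \<Rightarrow> 'v::{finite,linorder} set set) \<Rightarrow> nat \<Rightarrow> enat \<Rightarrow> nat" where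
  "bar_mult p N F s t = vdim (P_space p N F s t)"

definition end_times :: "nat \<Rightarrow> enat set" where
  "end_times N = enat ` {0..N} \<union> {\<infinity>}"

definition barcode ::
  "nat \<Rightarrow> nat \<Rightarrow> (nat \<Rightarrow> 'v::{finite,linorder} set set) \<Rightarrow> (nat \<times> enat \<times> nat) set" where
  "barcode p N F = {(s, t, bar_mult p N F s t) | s t.
     s \<le> N \<and> t \<in> end_times N \<and> enat s < t \<and> bar_mult p N F s t > 0}"

definition simple_bar ::
  "nat \<Rightarrow> nat \<Rightarrow> (nat \<Rightarrow> 'v::{finite,linorder} set set) \<Rightarrow> nat \<Rightarrow> enat \<Rightarrow> bool" where
  "simple_bar p N F s t \<longleftrightarrow> bar_mult p N F s t = 1"

definition generic_bar ::
  "nat \<Rightarrow> nat \<Rightarrow> (nat \<Rightarrow> 'v::{finite,linorder} set set) \<Rightarrow> nat \<Rightarrow> enat \<Rightarrow> bool" where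
  "generic_bar p N F s t \<longleftrightarrow> simple_bar p N F s t \<and>
     (\<forall>t'\<in>end_times N. enat s < t' \<and> t' \<noteq> t \<longrightarrow> bar_mult p N F s t' = 0)"

section \<open>Harmonic representatives\<close>

definition harmonic :: "nat \<Rightarrow> 'v::{finite,linorder} set set \<Rightarrow> 'v chain set" where
  "harmonic p K = cycles p K \<inter> orthogonal_comp (boundaries p K)"

definition orthogonal_projection :: "'a::real_inner set \<Rightarrow> 'a \<Rightarrow> 'a" where
  "orthogonal_projection U z = (THE u. u \<in> U \<and> z - u \<in> orthogonal_comp U)"

definition harmonic_map :: "nat \<Rightarrow> 'v::{finite,linorder} set set \<Rightarrow> 'v chain \<Rightarrow> 'v chain" where
  "harmonic_map p L z = orthogonal_projection (orthogonal_comp (boundaries p L)) z"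

definition harmonic_M ::
  "nat \<Rightarrow> (nat \<Rightarrow> 'v::{finite,linorder} set set) \<Rightarrow> nat \<Rightarrow> nat \<Rightarrow> 'v chain set" where
  "harmonic_M p F s t = {z \<in> harmonic p (F s).
     harmonic_map p (F t) z \<in> harmonic_map p (F t) ` harmonic p (before F s)}"

definition harmonic_P ::
  "nat \<Rightarrow> nat \<Rightarrow> (nat \<Rightarrow> 'v::{finite,linorder} set set) \<Rightarrow> nat \<Rightarrow> enat \<Rightarrow> 'v chain set" where
  "harmonic_P p N F s t = (case t of
     enat u \<Rightarrow> harmonic_M p F s u \<inter> orthogonal_comp (harmonic_M p F s (u - 1))
   | \<infinity> \<Rightarrow> harmonic p (F s) \<inter> orthogonal_comp (harmonic_M p F s N))"

definition harmonic_representative ::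
  "nat \<Rightarrow> nat \<Rightarrow> (nat \<Rightarrow> 'v::{finite,linorder} set set) \<Rightarrow> nat \<Rightarrow> enat \<Rightarrow> 'v chain \<Rightarrow> bool" where
  "harmonic_representative p N F s t z \<longleftrightarrow> z \<in> harmonic_P p N F s t \<and> z \<noteq> 0"

section \<open>Essential simplices\<close>

definition M_cycles ::
  "nat \<Rightarrow> (nat \<Rightarrow> 'v::{finite,linorder} set set) \<Rightarrow> nat \<Rightarrow> nat \<Rightarrow> 'v chain set" where
  "M_cycles p F s t = {z \<in> cycles p (F s). homology_class p (F s) z \<in> M_sub p F s t}"

definition representatives ::
  "nat \<Rightarrow> nat \<Rightarrow> (nat \<Rightarrow> 'v::{finite,linorder} set set) \<Rightarrow> nat \<Rightarrow> enat \<Rightarrow> 'v chain set" where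
  "representatives p N F s t = (case t of
     enat u \<Rightarrow> M_cycles p F s u - M_cycles p F s (u - 1)
   | \<infinity> \<Rightarrow> cycles p (F s) - M_cycles p F s N)"

definition essential_simplices ::
  "nat \<Rightarrow> nat \<Rightarrow> (nat \<Rightarrow> 'v::{finite,linorder} set set) \<Rightarrow> nat \<Rightarrow> enat \<Rightarrow> 'v set set" where
  "essential_simplices p N F s t = (\<Inter>z\<in>representatives p N F s t. supp z)"

end

theory Submission
  imports Defs
begin

text \<open>
  Write \<open>Z\<close> for the cycles of \<open>F s\<close>. Since the bar is generic, its representatives are the elements
  of \<open>Z - W\<close>, where \<open>W\<close> is a subspace of \<open>Z\<close> orthogonal to \<open>z\<^sub>0\<close>. If \<open>\<sigma>\<close> is essential, then \<open>W\<close>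
  contains all cycles that vanish at \<open>\<sigma>\<close>, so on \<open>Z\<close> the functionals \<open>z \<mapsto> z \<bullet> z\<^sub>0\<close> and \<open>z \<mapsto> z $ \<sigma>\<close> are
  proportional: up to a factor, \<open>z\<^sub>0\<close> is the orthogonal projection of the basis vector \<open>\<sigma>\<close> to \<open>Z\<close>.

  For \<open>p = 0\<close> this projection is \<open>\<sigma>\<close> itself. For \<open>p = 1\<close>, the chain \<open>z\<^sub>0\<close> is a flow that agrees off
  \<open>\<sigma>\<close> with the potential differences of a function on the vertices. Cutting the graph at the
  potential of the higher end of \<open>\<tau>\<close>, all edges but \<open>\<sigma>\<close> carry the flow across the cut in the same
  direction, so their total, and in particular the flow through \<open>\<tau>\<close>, is balanced by \<open>\<sigma>\<close>. In case of
  equality, \<open>\<sigma>\<close> and \<open>\<tau>\<close> are the only edges of the cut, and every cycle has coefficients of equal size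
  there. Conversely, if \<open>\<tau>\<close> is essential, then the inequality holds in both directions.
\<close>

section \<open>Parametrized vector spaces\<close>

text \<open>
  The carriers of homology and its subquotients are sets of cosets, nested up to twice. Presenting
  them all as linear images of spaces of chains keeps linear algebra on the level of chains.
\<close>

definition lin_param :: "(real, 'b) module \<Rightarrow> 'a::real_vector set \<Rightarrow> ('a \<Rightarrow> 'b) \<Rightarrow> bool" where
  "lin_param V U \<pi> \<longleftrightarrow> subspace U \<and> carrier V = \<pi> ` U \<and> \<zero>\<^bsub>V\<^esub> = \<pi> 0 \<and>
     (\<forall>x\<in>U. \<forall>y\<in>U. \<pi> x \<oplus>\<^bsub>V\<^esub> \<pi> y = \<pi> (x + y)) \<and> (\<forall>r. \<forall>x\<in>U. r \<odot>\<^bsub>V\<^esub> \<pi> x = \<pi> (r *\<^sub>R x))"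

lemma lin_param_lin_space: "subspace U \<Longrightarrow> lin_param (lin_space U) U (\<lambda>x. x)"
  by (simp add: lin_param_def lin_space_def)

lemma lin_param_restrict:
  assumes "lin_param V U \<pi>" "subspace U'" "U' \<subseteq> U"
  shows "lin_param (V\<lparr>carrier := \<pi> ` U'\<rparr>) U' \<pi>"
  using assms unfolding lin_param_def by (simp add: subset_iff)

lemma lin_param_coset:
  assumes "lin_param V U \<pi>" "U' \<subseteq> U" "x \<in> U"
  shows "\<pi> ` U' +>\<^bsub>V\<^esub> \<pi> x = \<pi> ` {u + x |u. u \<in> U'}"
proof -
  have "\<pi> ` U' +>\<^bsub>V\<^esub> \<pi> x = (\<lambda>u. \<pi> u \<oplus>\<^bsub>V\<^esub> \<pi> x) ` U'"
    by (auto simp: a_r_coset_def')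
  also have "\<dots> = (\<lambda>u. \<pi> (u + x)) ` U'"
    using assms by (intro image_cong) (auto simp: lin_param_def)
  finally show ?thesis
    by auto
qed

text \<open>The parameter space \<open>U\<close> stays the same and only the map changes. The lemma
  can therefore be iterated, first for homology and then for its subquotients.\<close>

lemma lin_param_quotient:
  assumes V: "lin_param V U \<pi>" and U': "subspace U'" "U' \<subseteq> U"
  shows "lin_param (quotient_space V (\<pi> ` U')) U (\<lambda>x. \<pi> ` U' +>\<^bsub>V\<^esub> \<pi> x)"
proof -
  note coset = lin_param_coset[OF V U'(2)]
  have U: "subspace U" and add: "\<And>x y. x \<in> U \<Longrightarrow> y \<in> U \<Longrightarrow> \<pi> x \<oplus>\<^bsub>V\<^esub> \<pi> y = \<pi> (x + y)"
    and smult: "\<And>r x. x \<in> U \<Longrightarrow> r \<odot>\<^bsub>V\<^esub> \<pi> x = \<pi> (r *\<^sub>R x)"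
    using V by (auto simp: lin_param_def)
  have sum_in: "u + x \<in> U" if "u \<in> U'" "x \<in> U" for u x
    using U U' that by (auto intro: subspace_add)
  have "\<pi> ` U' +>\<^bsub>V\<^esub> \<pi> 0 = \<pi> ` U'"
    using coset[of 0] U by (simp add: subspace_0)
  moreover have "set_add V (\<pi> ` U' +>\<^bsub>V\<^esub> \<pi> x) (\<pi> ` U' +>\<^bsub>V\<^esub> \<pi> y) = \<pi> ` U' +>\<^bsub>V\<^esub> \<pi> (x + y)"
    (is "?l = ?r") if xy: "x \<in> U" "y \<in> U" for x y
  proof -
    have "?l = (\<Union>u\<in>U'. \<Union>v\<in>U'. {\<pi> (u + x) \<oplus>\<^bsub>V\<^esub> \<pi> (v + y)})"
      using xy by (auto simp: set_add_def set_mult_def coset)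
    also have "\<dots> = (\<Union>u\<in>U'. \<Union>v\<in>U'. {\<pi> ((u + v) + (x + y))})"
      using xy by (intro SUP_cong refl) (auto simp: add sum_in algebra_simps)
    also have "\<dots> = \<pi> ` {u + (x + y) |u. u \<in> U'}"
    proof (intro equalityI subsetI)
      fix a assume "a \<in> \<pi> ` {u + (x + y) |u. u \<in> U'}"
      then obtain u where "u \<in> U'" "a = \<pi> ((u + 0) + (x + y))"
        by auto
      then show "a \<in> (\<Union>u\<in>U'. \<Union>v\<in>U'. {\<pi> ((u + v) + (x + y))})"
        using subspace_0[OF U'(1)] by blast
    qed (use U'(1) in \<open>auto intro: subspace_add\<close>)
    also have "\<dots> = ?r"
      using xy U by (simp add: coset subspace_add)
    finally show ?thesis .
  qed
  moreover have "(\<Union>a\<in>\<pi> ` U' +>\<^bsub>V\<^esub> \<pi> x. \<pi> ` U' +>\<^bsub>V\<^esub> (r \<odot>\<^bsub>V\<^esub> a)) = \<pi> ` U' +>\<^bsub>V\<^esub> \<pi> (r *\<^sub>R x)"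
    (is "?l = ?r") if x: "x \<in> U" for x r
  proof -
    \<comment> \<open>Scalar multiplication in \<open>quotient_space\<close> is a union over all
      elements of a coset. Each of them contributes the same coset, since the shift
      \<open>r *\<^sub>R u\<close> is absorbed by \<open>U'\<close>.\<close>
    have *: "\<pi> ` U' +>\<^bsub>V\<^esub> (r \<odot>\<^bsub>V\<^esub> \<pi> (u + x)) = ?r" if u: "u \<in> U'" for u
    proof -
      have "\<pi> ` U' +>\<^bsub>V\<^esub> (r \<odot>\<^bsub>V\<^esub> \<pi> (u + x)) = \<pi> ` {w + r *\<^sub>R (u + x) |w. w \<in> U'}"
        using x u U by (simp add: smult sum_in coset subspace_scale)
      also have "{w + r *\<^sub>R (u + x) |w. w \<in> U'} = {w + r *\<^sub>R x |w. w \<in> U'}"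
      proof (intro equalityI subsetI)
        fix a assume "a \<in> {w + r *\<^sub>R x |w. w \<in> U'}"
        then obtain w where "w \<in> U'" "a = (w - r *\<^sub>R u) + r *\<^sub>R (u + x)"
          by (auto simp: algebra_simps)
        then show "a \<in> {w + r *\<^sub>R (u + x) |w. w \<in> U'}"
          using U'(1) u by (blast intro: subspace_diff subspace_scale)
      next
        fix a assume "a \<in> {w + r *\<^sub>R (u + x) |w. w \<in> U'}"
        then obtain w where "w \<in> U'" "a = (w + r *\<^sub>R u) + r *\<^sub>R x"
          by (auto simp: algebra_simps)
        then show "a \<in> {w + r *\<^sub>R x |w. w \<in> U'}"
          using U'(1) u by (blast intro: subspace_add subspace_scale)
      qed
      also have "\<pi> ` {w + r *\<^sub>R x |w. w \<in> U'} = ?r"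
        using x U by (simp add: coset subspace_scale)
      finally show ?thesis .
    qed
    have "?l = (\<Union>u\<in>U'. \<pi> ` U' +>\<^bsub>V\<^esub> (r \<odot>\<^bsub>V\<^esub> \<pi> (u + x)))"
      by (auto simp: coset[OF x])
    also have "\<dots> = ?r"
      using * subspace_0[OF U'(1)] by auto
    finally show ?thesis .
  qed
  moreover have "a_rcosets\<^bsub>V\<^esub> (\<pi> ` U') = (\<lambda>x. \<pi> ` U' +>\<^bsub>V\<^esub> \<pi> x) ` U"
    using V by (auto simp: A_RCOSETS_def' lin_param_def)
  ultimately show ?thesis
    using U by (simp add: lin_param_def quotient_space_def)
qed

lemma lin_param_abelian_monoid:
  assumes V: "lin_param V U \<pi>"
  shows "abelian_monoid V"
proof -
  have U: "subspace U" and add: "\<And>x y. x \<in> U \<Longrightarrow> y \<in> U \<Longrightarrow> \<pi> x \<oplus>\<^bsub>V\<^esub> \<pi> y = \<pi> (x + y)"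
    and car: "carrier V = \<pi> ` U" and zero: "\<zero>\<^bsub>V\<^esub> = \<pi> 0"
    using V by (auto simp: lin_param_def)
  show ?thesis
  proof (rule abelian_monoidI, unfold car zero, goal_cases)
    case (1 x y)
    then show ?case
      using U by (auto simp: add subspace_add)
  next
    case 2
    then show ?case
      using U by (simp add: subspace_0)
  next
    case (3 x y z)
    then show ?case
      using U by (auto simp: add subspace_add add.assoc)
  next
    case (4 x)
    then show ?case
      using U by (auto simp: add subspace_0)
  next
    case (5 x y)
    then show ?case
      by (auto simp: add add.commute)
  qed
qed

text \<open>Injectivity on \<open>C\<close> keeps the images of distinct elements apart, so that a
  sum over the image set can be indexed by \<open>C\<close> itself.\<close>

lemma lin_param_finsum:
  assumes V: "lin_param V U \<pi>" and "finite C" "C \<subseteq> U" "inj_on \<pi> C"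
  shows "(\<Oplus>\<^bsub>V\<^esub>v\<in>\<pi> ` C. c v \<odot>\<^bsub>V\<^esub> v) = \<pi> (\<Sum>x\<in>C. c (\<pi> x) *\<^sub>R x)"
  using assms(2-)
proof (induction C rule: finite_induct)
  case empty
  then show ?case
    using V by (simp add: abelian_monoid.finsum_empty[OF lin_param_abelian_monoid[OF V]] lin_param_def)
next
  case (insert x C)
  have U: "subspace U" and add: "\<And>x y. x \<in> U \<Longrightarrow> y \<in> U \<Longrightarrow> \<pi> x \<oplus>\<^bsub>V\<^esub> \<pi> y = \<pi> (x + y)"
    and smult: "\<And>r x. x \<in> U \<Longrightarrow> r \<odot>\<^bsub>V\<^esub> \<pi> x = \<pi> (r *\<^sub>R x)" and car: "carrier V = \<pi> ` U"
    using V by (auto simp: lin_param_def)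
  have closed: "c v \<odot>\<^bsub>V\<^esub> v \<in> carrier V" if "v \<in> \<pi> ` insert x C" for v
  proof -
    have "v \<in> \<pi> ` U"
      using that image_mono[OF insert.prems(1)] by (rule rev_subsetD)
    then obtain y where "y \<in> U" "v = \<pi> y"
      by auto
    then show ?thesis
      using U by (simp add: smult car subspace_scale)
  qed
  have "(\<Oplus>\<^bsub>V\<^esub>v\<in>\<pi> ` insert x C. c v \<odot>\<^bsub>V\<^esub> v)
      = c (\<pi> x) \<odot>\<^bsub>V\<^esub> \<pi> x \<oplus>\<^bsub>V\<^esub> (\<Oplus>\<^bsub>V\<^esub>v\<in>\<pi> ` C. c v \<odot>\<^bsub>V\<^esub> v)"
    using insert.hyps insert.prems closed
    by (simp add: abelian_monoid.finsum_insert[OF lin_param_abelian_monoid[OF V]] Pi_iff)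
  also have "\<dots> = \<pi> (c (\<pi> x) *\<^sub>R x + (\<Sum>x\<in>C. c (\<pi> x) *\<^sub>R x))"
  proof -
    have "x \<in> U" "C \<subseteq> U" "inj_on \<pi> C"
      using insert.prems by auto
    moreover from this have "(\<Sum>x\<in>C. c (\<pi> x) *\<^sub>R x) \<in> U"
      using U by (intro subspace_sum subspace_scale) auto
    ultimately show ?thesis
      using U by (simp add: insert.IH smult add subspace_scale)
  qed
  finally show ?case
    using insert.hyps by simp
qed

text \<open>On the orthogonal complement of the kernel of \<open>\<pi>\<close> in \<open>U\<close>,
  the map \<open>\<pi>\<close> is injective and still reaches the whole carrier, so a basis of this
  complement is carried to a basis of \<open>V\<close>.\<close>

lemma lin_param_ex_basis:
  fixes U :: "'a::euclidean_space set"
  assumes V: "lin_param V U \<pi>"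
  shows "\<exists>S. is_basis V S"
proof -
  have U: "subspace U" and add: "\<And>x y. x \<in> U \<Longrightarrow> y \<in> U \<Longrightarrow> \<pi> x \<oplus>\<^bsub>V\<^esub> \<pi> y = \<pi> (x + y)"
    and smult: "\<And>r x. x \<in> U \<Longrightarrow> r \<odot>\<^bsub>V\<^esub> \<pi> x = \<pi> (r *\<^sub>R x)" and car: "carrier V = \<pi> ` U"
    using V by (auto simp: lin_param_def)
  define k where "k = {x\<in>U. \<pi> x = \<pi> 0}"
  have k_add: "x + y \<in> k" if "x \<in> k" "y \<in> k" for x y
    using that add[of x y] add[of 0 0] U by (simp add: k_def subspace_add subspace_0)
  have k_scale: "r *\<^sub>R x \<in> k" if "x \<in> k" for r x
    using that smult[of x r] smult[of 0 r] U by (simp add: k_def subspace_scale subspace_0)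
  have k: "subspace k"
    using k_add k_scale U by (auto simp: subspace_def k_def)
  \<comment> \<open>Subtraction is expressed by the addition of \<open>V\<close>: the image of
    \<open>- y\<close> is added to both sides of \<open>\<pi> x = \<pi> y\<close>.\<close>
  have \<pi>_diff: "x - y \<in> k" if xy: "x \<in> U" "y \<in> U" "\<pi> x = \<pi> y" for x y
  proof -
    have "- y \<in> U"
      using xy U by (simp add: subspace_neg)
    then have "\<pi> (x - y) = \<pi> (y - y)"
      using add[of x "- y"] add[of y "- y"] xy by simp
    then show ?thesis
      using xy U by (simp add: k_def subspace_diff)
  qed
  define C0 where "C0 = U \<inter> orthogonal_comp k"
  have C0: "subspace C0" "C0 \<subseteq> U"
    using U by (auto simp: C0_def subspace_orthogonal_comp subspace_inter)
  have inj: "inj_on \<pi> C0"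
  proof (rule inj_onI)
    fix x y assume xy: "x \<in> C0" "y \<in> C0" "\<pi> x = \<pi> y"
    have "x \<in> U" "y \<in> U"
      using xy C0 by blast+
    then have "x - y \<in> k"
      using xy(3) by (rule \<pi>_diff)
    moreover have "x - y \<in> orthogonal_comp k"
      using subspace_diff[OF C0(1) xy(1,2)] by (simp add: C0_def)
    ultimately have "orthogonal (x - y) (x - y)"
      unfolding orthogonal_comp_def by blast
    then show "x = y"
      by (simp add: orthogonal_def)
  qed
  obtain C where C: "C \<subseteq> C0" "independent C" "C0 \<subseteq> span C"
    by (rule basis_exists)
  have finC: "finite C"
    using C(2) independent_imp_finite by blast
  have CU: "C \<subseteq> U" and injC: "inj_on \<pi> C"
    using C C0 inj by (auto intro: inj_on_subset)
  note finsum = lin_param_finsum[OF V finC CU injC]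
  have lin_C0: "(\<Sum>x\<in>C. c x *\<^sub>R x) \<in> C0" for c
    using C C0 by (auto intro!: subspace_sum subspace_scale)
  have "\<exists>!c. c \<in> extensional (\<pi> ` C) \<and> v = (\<Oplus>\<^bsub>V\<^esub>x\<in>\<pi> ` C. c x \<odot>\<^bsub>V\<^esub> x)" if v: "v \<in> carrier V" for v
  proof (rule ex_ex1I)
    obtain u where u: "u \<in> U" "v = \<pi> u"
      using v car by auto
    obtain a b where ab: "a \<in> span k" "\<And>w. w \<in> span k \<Longrightarrow> orthogonal b w" "u = a + b"
      using orthogonal_subspace_decomp_exists[of k u] by metis
    have span_k: "span k = k"
      using k span_eq_iff by blast
    have a: "a \<in> k" and b: "b \<in> orthogonal_comp k"
      using ab(1,2) unfolding span_k orthogonal_comp_def by (auto simp: orthogonal_commute)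
    then have aU: "a \<in> U" "\<pi> a = \<pi> 0"
      by (auto simp: k_def)
    moreover have bU: "b \<in> U"
      using subspace_diff[OF U u(1) aU(1)] ab by simp
    ultimately have "\<pi> u = \<pi> b"
      using add[of a b] add[of 0 b] U ab by (simp add: subspace_0)
    have "b \<in> span C"
      using b bU C by (auto simp: C0_def)
    then obtain r where r: "b = (\<Sum>x\<in>C. r x *\<^sub>R x)"
      using finC by (auto simp: span_finite)
    \<comment> \<open>The coefficients are transported to the image of \<open>C\<close>;
      \<open>restrict\<close> provides the extensionality that makes them unique in
      \<open>is_basis\<close>.\<close>
    define c where "c = restrict (r \<circ> inv_into C \<pi>) (\<pi> ` C)"
    have "(\<Sum>x\<in>C. c (\<pi> x) *\<^sub>R x) = b"
      using injC by (auto simp: r c_def intro!: sum.cong)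
    then show "\<exists>c. c \<in> extensional (\<pi> ` C) \<and> v = (\<Oplus>\<^bsub>V\<^esub>x\<in>\<pi> ` C. c x \<odot>\<^bsub>V\<^esub> x)"
      using \<open>\<pi> u = \<pi> b\<close> u by (intro exI[of _ c]) (auto simp: finsum c_def)
  next
    fix c d
    assume "c \<in> extensional (\<pi> ` C) \<and> v = (\<Oplus>\<^bsub>V\<^esub>x\<in>\<pi> ` C. c x \<odot>\<^bsub>V\<^esub> x)"
      and "d \<in> extensional (\<pi> ` C) \<and> v = (\<Oplus>\<^bsub>V\<^esub>x\<in>\<pi> ` C. d x \<odot>\<^bsub>V\<^esub> x)"
    then have cd: "c \<in> extensional (\<pi> ` C)" "d \<in> extensional (\<pi> ` C)"
      and "\<pi> (\<Sum>x\<in>C. c (\<pi> x) *\<^sub>R x) = \<pi> (\<Sum>x\<in>C. d (\<pi> x) *\<^sub>R x)"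
      by (auto simp: finsum)
    then have "(\<Sum>x\<in>C. c (\<pi> x) *\<^sub>R x) = (\<Sum>x\<in>C. d (\<pi> x) *\<^sub>R x)"
      using inj_onD[OF inj _ lin_C0[of "\<lambda>x. c (\<pi> x)"] lin_C0[of "\<lambda>x. d (\<pi> x)"]] by simp
    then have "(\<Sum>x\<in>C. (c (\<pi> x) - d (\<pi> x)) *\<^sub>R x) = 0"
      by (simp add: scaleR_diff_left sum_subtractf)
    then have "c (\<pi> x) - d (\<pi> x) = 0" if "x \<in> C" for x
      using independentD[OF C(2) finC order_refl, of "\<lambda>x. c (\<pi> x) - d (\<pi> x)"] that by simp
    then show "c = d"
      using cd by (auto intro!: extensionalityI[of _ "\<pi> ` C"])
  qed
  then show ?thesis
    unfolding is_basis_def using finC image_mono[OF CU, of \<pi>] by (intro exI[of _ "\<pi> ` C"]) (simp add: car)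
qed

text \<open>The value 0 of \<open>vdim\<close> is also its default in the absence of a basis. A
  basis exists here, and the chosen one is finite of cardinality 0, so every vector is an empty
  sum.\<close>

lemma vdim_eq_0:
  fixes U :: "'a::euclidean_space set"
  assumes "lin_param V U \<pi>" "vdim V = 0"
  shows "carrier V = {\<zero>\<^bsub>V\<^esub>}"
proof -
  have "\<exists>S. is_basis V S"
    using lin_param_ex_basis[OF assms(1)] .
  then have basis: "is_basis V (SOME S. is_basis V S)"
    by (rule someI_ex)
  have "card (SOME S. is_basis V S) = 0"
    using assms(2) \<open>\<exists>S. is_basis V S\<close> by (simp add: vdim_def)
  moreover have "finite (SOME S. is_basis V S)"
    using basis unfolding is_basis_def[of V "SOME S. is_basis V S"] by blast
  ultimately have "is_basis V {}"
    using basis by simp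
  then have "carrier V \<subseteq> {\<zero>\<^bsub>V\<^esub>}"
    by (auto simp: is_basis_def abelian_monoid.finsum_empty[OF lin_param_abelian_monoid[OF assms(1)]])
  moreover have "\<zero>\<^bsub>V\<^esub> \<in> carrier V"
    using lin_param_abelian_monoid[OF assms(1)] by (rule abelian_monoid.zero_closed)
  ultimately show ?thesis
    by (auto simp: subset_singleton_iff)
qed

text \<open>This is how vanishing multiplicities are exploited. All cosets coincide with the
  subspace, and each contains its own representative.\<close>

lemma vdim_quotient_eq_0:
  fixes U :: "'a::euclidean_space set"
  assumes V: "lin_param V U \<pi>" and U': "subspace U'" "U' \<subseteq> U"
    and 0: "vdim (quotient_space V (\<pi> ` U')) = 0"
  shows "carrier V = \<pi> ` U'"
proof -
  have U: "subspace U" and car: "carrier V = \<pi> ` U"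
    using V by (auto simp: lin_param_def)
  have "\<pi> x \<in> \<pi> ` U'" if x: "x \<in> U" for x
  proof -
    have "carrier (quotient_space V (\<pi> ` U')) = (\<lambda>x. \<pi> ` U' +>\<^bsub>V\<^esub> \<pi> x) ` U"
      using lin_param_quotient[OF assms(1-3)] by (simp add: lin_param_def)
    then have "\<pi> ` U' +>\<^bsub>V\<^esub> \<pi> x \<in> carrier (quotient_space V (\<pi> ` U'))"
      using x by blast
    then have "\<pi> ` U' +>\<^bsub>V\<^esub> \<pi> x = \<pi> ` U'"
      using vdim_eq_0[OF lin_param_quotient[OF assms(1-3)] 0] by (simp add: quotient_space_def)
    then have eq: "\<pi> ` {u + x |u. u \<in> U'} = \<pi> ` U'"
      using lin_param_coset[OF V U'(2) x] by simp
    have "x \<in> {u + x |u. u \<in> U'}"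
      using subspace_0[OF U'(1)] by force
    then show ?thesis
      unfolding eq[symmetric] by (rule imageI)
  qed
  then show ?thesis
    unfolding car using U'(2) by (intro equalityI image_subsetI image_mono)
qed

section \<open>Chains, boundaries and coboundaries\<close>

lemma subspace_chains: "subspace (chains p K)"
proof -
  have "chains p K = {z. \<forall>\<sigma>. \<sigma> \<notin> simplices p K \<longrightarrow> z $ \<sigma> = 0}"
    by (auto simp: chains_def supp_def)
  then show ?thesis
    by (simp add: subspace_def)
qed

lemma chains_nth_eq_0: "z \<in> chains p K \<Longrightarrow> \<sigma> \<notin> simplices p K \<Longrightarrow> z $ \<sigma> = 0"
  by (auto simp: chains_def supp_def)

lemma chains_mono: "K \<subseteq> L \<Longrightarrow> chains p K \<subseteq> chains p L"
  by (auto simp: chains_def simplices_def)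

lemma linear_boundary: "linear (boundary p)"
  by (rule linearI)
    (auto simp: boundary_def scaleR_add_left sum.distrib scaleR_sum_right)

lemma subspace_cycles: "subspace (cycles p K)"
proof -
  have "cycles p K = chains p K \<inter> {z. boundary p z = 0}"
    by (auto simp: cycles_def)
  then show ?thesis
    using subspace_inter[OF subspace_chains linear_subspace_kernel[OF linear_boundary]] by simp
qed

lemma subspace_boundaries: "subspace (boundaries p K)"
  unfolding boundaries_def by (intro linear_subspace_image linear_boundary subspace_chains)

lemma boundaries_mono: "K \<subseteq> L \<Longrightarrow> boundaries p K \<subseteq> boundaries p L"
  unfolding boundaries_def by (intro image_mono chains_mono)

lemma boundary_simplex_nth_nonzero:
  assumes "boundary_simplex \<sigma> $ \<tau> \<noteq> 0"
  obtains x where "x \<in> \<sigma>" "\<tau> = \<sigma> - {x}"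
proof -
  obtain j where j: "j < card \<sigma>" "\<tau> = \<sigma> - {sorted_list_of_set \<sigma> ! j}"
    using assms unfolding boundary_simplex_def
    by (auto simp: axis_def elim!: sum.not_neutral_contains_not_neutral split: if_splits)
  moreover have "sorted_list_of_set \<sigma> ! j \<in> set (sorted_list_of_set \<sigma>)"
    using j(1) by (intro nth_mem) simp
  ultimately show ?thesis
    using that by simp
qed

lemma boundary_in_chains:
  assumes K: "simplicial_complex K" and z: "z \<in> chains (Suc p) K"
  shows "boundary (Suc p) z \<in> chains p K"
proof -
  have "\<tau> \<in> simplices p K" if "boundary (Suc p) z $ \<tau> \<noteq> 0" for \<tau>
  proof -
    have "(\<Sum>\<sigma> | card \<sigma> = Suc (Suc p). z $ \<sigma> * boundary_simplex \<sigma> $ \<tau>) \<noteq> 0"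
      using that by (simp add: boundary_def)
    then obtain \<sigma> where "\<sigma> \<in> {\<sigma>. card \<sigma> = Suc (Suc p)}" "z $ \<sigma> * boundary_simplex \<sigma> $ \<tau> \<noteq> 0"
      by (rule sum.not_neutral_contains_not_neutral)
    then have \<sigma>: "card \<sigma> = Suc (Suc p)" "z $ \<sigma> \<noteq> 0" "boundary_simplex \<sigma> $ \<tau> \<noteq> 0"
      by auto
    obtain x where x: "x \<in> \<sigma>" "\<tau> = \<sigma> - {x}"
      using \<sigma>(3) by (rule boundary_simplex_nth_nonzero)
    have "\<sigma> \<in> K"
      using z \<sigma>(2) by (auto simp: chains_def supp_def simplices_def)
    then have "\<tau> \<in> K"
      using K x by (auto simp: simplicial_complex_def)
    then show ?thesis
      using x \<sigma>(1) by (simp add: simplices_def)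
  qed
  then show ?thesis
    by (auto simp: chains_def supp_def)
qed

text \<open>This is the simplicial coboundary of a function on the vertices: its potential
  difference along each edge, oriented from the smaller to the larger vertex. All two-element sets
  count as edges, whether or not they belong to a given complex.\<close>

definition coboundary :: "('v::{finite,linorder} \<Rightarrow> real) \<Rightarrow> 'v chain" where
  "coboundary g = (\<chi> e. if card e = 2 then g (Max e) - g (Min e) else 0)"

lemma card_2_obtain:
  fixes e :: "'v::linorder set"
  assumes "card e = 2"
  obtains a b where "e = {a, b}" "a < b" "Min e = a" "Max e = b"
proof -
  obtain x y where xy: "e = {x, y}" "x \<noteq> y"
    using assms by (auto simp: card_2_iff)
  show thesis
  proof (cases "x < y")
    case True
    then show ?thesis
      using xy by (intro that[of x y]) auto
  next
    case False
    then have "y < x"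
      using xy by simp
    then show ?thesis
      using xy by (intro that[of y x]) auto
  qed
qed

lemma boundary_simplex_edge:
  assumes "a < b"
  shows "boundary_simplex {a, b} = axis {b} 1 - axis {a} 1"
proof -
  have "sorted_list_of_set {a, b} = [a, b]" "card {a, b} = Suc (Suc 0)" "{a, b} - {a} = {b}" "{a, b} - {b} = {a}"
    using assms by auto
  then show ?thesis
    by (simp add: boundary_simplex_def del: sorted_list_of_set_insert_remove)
qed

lemma boundary_simplex_triangle:
  assumes "a < b" "b < c"
  shows "boundary_simplex {a, b, c} = axis {b, c} 1 - axis {a, c} 1 + axis {a, b} 1"
proof -
  have "a \<noteq> b" "b \<noteq> c" "a \<noteq> c" "a < c"
    using assms by auto
  then have "sorted_list_of_set {a, b, c} = [a, b, c]" "card {a, b, c} = Suc (Suc (Suc 0))"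
    "{a, b, c} - {a} = {b, c}" "{a, b, c} - {b} = {a, c}" "{a, b, c} - {c} = {a, b}"
    using assms by auto
  then show ?thesis
    by (simp add: boundary_simplex_def del: sorted_list_of_set_insert_remove)
qed

lemma boundary_simplex_nth_vertex:
  assumes "card e = 2"
  shows "boundary_simplex e $ {v} = coboundary (indicator {v}) $ e"
  using assms by (elim card_2_obtain) (auto simp: boundary_simplex_edge coboundary_def axis_def)

lemma boundary_1_nth: "boundary (Suc 0) z $ {v} = z \<bullet> coboundary (indicator {v})"
proof -
  have "boundary (Suc 0) z $ {v} = (\<Sum>e | card e = 2. z $ e * coboundary (indicator {v}) $ e)"
    by (simp add: boundary_def boundary_simplex_nth_vertex numeral_2_eq_2)
  also have "\<dots> = z \<bullet> coboundary (indicator {v})"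
    unfolding inner_vec_def by (intro sum.mono_neutral_cong_left) (auto simp: coboundary_def)
  finally show ?thesis .
qed

text \<open>The coboundary is adjoint to the boundary. Vertex indicators span all functions on the
  vertices, and the boundary of an edge has no coefficients except at single vertices.\<close>

lemma boundary_1_eq_0_iff:
  fixes z :: "'v::{finite,linorder} chain"
  shows "boundary (Suc 0) z = 0 \<longleftrightarrow> (\<forall>g. z \<bullet> coboundary g = 0)"
proof (intro iffI allI)
  fix g :: "'v \<Rightarrow> real"
  assume z: "boundary (Suc 0) z = 0"
  have "coboundary g = (\<Sum>v\<in>UNIV. g v *\<^sub>R coboundary (indicator {v}))"
    by (auto simp: coboundary_def vec_eq_iff indicator_def algebra_simps sum_subtractf if_distrib
        cong: if_cong)
  then show "z \<bullet> coboundary g = 0"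
    using z by (simp add: inner_sum_right flip: boundary_1_nth)
next
  assume z: "\<forall>g. z \<bullet> coboundary g = 0"
  have "boundary (Suc 0) z $ \<tau> = 0" for \<tau>
  proof (cases "\<exists>v. \<tau> = {v}")
    case True
    then show ?thesis
      using z by (auto simp: boundary_1_nth)
  next
    case False
    have "boundary_simplex e $ \<tau> = 0" if "card e = 2" for e
      using that False by (elim card_2_obtain) (auto simp: boundary_simplex_edge axis_def)
    then show ?thesis
      by (simp add: boundary_def numeral_2_eq_2)
  qed
  then show "boundary (Suc 0) z = 0"
    by (simp add: vec_eq_iff)
qed

lemma mem_cycles_1_iff:
  "z \<in> cycles (Suc 0) K \<longleftrightarrow> z \<in> chains (Suc 0) K \<and> (\<forall>g. z \<bullet> coboundary g = 0)"
  by (simp add: cycles_def boundary_1_eq_0_iff)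

text \<open>Potential differences around a triangle cancel. Dually, the boundary of a triangle is a
  cycle.\<close>

lemma boundary_simplex_triangle_inner_coboundary:
  fixes \<sigma> :: "'v::{finite,linorder} set"
  assumes "card \<sigma> = 3"
  shows "boundary_simplex \<sigma> \<bullet> coboundary g = 0"
proof -
  have "\<exists>a b c. xs = [a, b, c]" if "length xs = 3" for xs :: "'v list"
    using that by (auto simp: length_Suc_conv numeral_3_eq_3)
  then obtain a b c where abc: "sorted_list_of_set \<sigma> = [a, b, c]"
    using assms by (metis length_sorted_list_of_set)
  have \<sigma>: "\<sigma> = {a, b, c}"
    using abc set_sorted_list_of_set[of \<sigma>] by simp
  have lt: "a < b" "b < c"
    using strict_sorted_list_of_set[of \<sigma>] abc by simp_all
  have "coboundary g $ {x, y} = g y - g x" if "x < y" for x y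
    using that by (simp add: coboundary_def)
  then show ?thesis
    using lt by (simp add: \<sigma> boundary_simplex_triangle inner_add_left inner_diff_left
        inner_axis' less_trans[of a b c])
qed

text \<open>In degree 0 the boundary map is zero by convention; in degree 1 the claim reduces to the
  cancellation around each triangle.\<close>

lemma boundaries_subset_cycles:
  assumes "simplicial_complex K" "p \<in> {0, 1}"
  shows "boundaries p K \<subseteq> cycles p K"
proof
  fix x assume "x \<in> boundaries p K"
  then obtain z where z: "z \<in> chains (Suc p) K" "x = boundary (Suc p) z"
    by (auto simp: boundaries_def)
  have x: "x \<in> chains p K"
    using boundary_in_chains[OF assms(1) z(1)] z(2) by simp
  show "x \<in> cycles p K"
  proof (cases "p = 0")
    case True
    then show ?thesis
      using x by (simp add: cycles_def boundary_def)
  next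
    case False
    then have p: "p = Suc 0"
      using assms(2) by simp
    have "x \<bullet> coboundary g = 0" for g
      by (simp add: z(2) p boundary_def inner_sum_left boundary_simplex_triangle_inner_coboundary
          numeral_3_eq_3)
    then show ?thesis
      using x by (simp add: p mem_cycles_1_iff)
  qed
qed

section \<open>Projections of edges to the cycle space of a graph\<close>

text \<open>The chains that agree with a coboundary on the edges of \<open>K\<close> form a subspace
  \<open>R\<close> whose orthogonal complement consists of cycles. Hence \<open>x\<close> lies in
  the double complement of \<open>R\<close>, which is \<open>R\<close>.\<close>

lemma orthogonal_cycles_1_potential:
  assumes x: "\<And>z. z \<in> cycles (Suc 0) K \<Longrightarrow> z \<bullet> x = 0"
  obtains f where "\<And>e. e \<in> simplices (Suc 0) K \<Longrightarrow> x $ e = coboundary f $ e"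
proof -
  define R where "R = {y. \<exists>g. \<forall>e\<in>simplices (Suc 0) K. y $ e = coboundary g $ e}"
  have "0 \<in> R"
    unfolding R_def by (rule CollectI, rule exI[of _ "\<lambda>_. 0"]) (simp add: coboundary_def)
  moreover have "x + y \<in> R" if xy: "x \<in> R" "y \<in> R" for x y
  proof -
    obtain f g where "\<forall>e\<in>simplices (Suc 0) K. x $ e = coboundary f $ e"
      "\<forall>e\<in>simplices (Suc 0) K. y $ e = coboundary g $ e"
      using xy unfolding R_def by blast
    then show ?thesis
      unfolding R_def
      by (intro CollectI exI[of _ "\<lambda>v. f v + g v"]) (simp add: coboundary_def)
  qed
  moreover have "r *\<^sub>R x \<in> R" if x: "x \<in> R" for r x
  proof -
    obtain f where "\<forall>e\<in>simplices (Suc 0) K. x $ e = coboundary f $ e"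
      using x unfolding R_def by blast
    then show ?thesis
      unfolding R_def
      by (intro CollectI exI[of _ "\<lambda>v. r * f v"]) (simp add: coboundary_def algebra_simps)
  qed
  ultimately have R: "subspace R"
    by (simp add: subspace_def)
  have "z \<in> cycles (Suc 0) K" if z: "z \<in> orthogonal_comp R" for z
  proof -
    have inner: "z \<bullet> y = 0" if "y \<in> R" for y
      using z that by (auto simp: orthogonal_comp_def orthogonal_def inner_commute)
    have "z $ \<tau> = 0" if \<tau>: "\<tau> \<notin> simplices (Suc 0) K" for \<tau>
    proof -
      \<comment> \<open>Coefficients outside \<open>K\<close> are free in \<open>R\<close>, with
        zero potential as witness. This forces \<open>z\<close> to be supported on
        \<open>K\<close>.\<close>
      have "axis \<tau> 1 \<in> R"
        unfolding R_def using \<tau>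
        by (intro CollectI exI[of _ "\<lambda>_. 0"]) (auto simp: coboundary_def axis_def)
      then show ?thesis
        using inner[of "axis \<tau> 1"] by (simp add: inner_axis)
    qed
    moreover have "z \<bullet> coboundary g = 0" for g
      by (rule inner) (auto simp: R_def)
    ultimately show ?thesis
      by (auto simp: mem_cycles_1_iff chains_def supp_def)
  qed
  then have "x \<in> orthogonal_comp (orthogonal_comp R)"
    using x by (auto simp: orthogonal_comp_def[of "orthogonal_comp R"] orthogonal_def)
  then have "x \<in> R"
    by (simp add: orthogonal_comp_self[OF R])
  then show thesis
    using that by (auto simp: R_def)
qed

text \<open>By \<open>proj\<close>, the difference of \<open>z\<^sub>0\<close> and \<open>k\<close>
  times the edge \<open>\<sigma>\<close> is orthogonal to all cycles, hence comes from a potential.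
  Since \<open>z\<^sub>0 $ \<tau>\<close> is nonzero, the ends of \<open>\<tau>\<close> have
  distinct potentials and a cut can separate them. The equality clause speaks of all cycles in order
  to transfer essentiality from \<open>\<sigma>\<close> to \<open>\<tau>\<close>.\<close>

lemma cycles_1_projection_cut:
  fixes z\<^sub>0 :: "'v::{finite,linorder} chain"
  assumes z\<^sub>0: "z\<^sub>0 \<in> cycles (Suc 0) K"
    and proj: "\<And>z. z \<in> cycles (Suc 0) K \<Longrightarrow> z \<bullet> z\<^sub>0 = k * z $ \<sigma>"
    and \<tau>: "\<tau> \<noteq> \<sigma>" "z\<^sub>0 $ \<tau> \<noteq> 0"
  shows "\<bar>z\<^sub>0 $ \<tau>\<bar> \<le> \<bar>z\<^sub>0 $ \<sigma>\<bar> \<and>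
    (\<bar>z\<^sub>0 $ \<tau>\<bar> = \<bar>z\<^sub>0 $ \<sigma>\<bar> \<longrightarrow> (\<forall>z\<in>cycles (Suc 0) K. \<bar>z $ \<tau>\<bar> = \<bar>z $ \<sigma>\<bar>))"
proof -
  have "z \<bullet> (z\<^sub>0 - k *\<^sub>R axis \<sigma> 1) = 0" if "z \<in> cycles (Suc 0) K" for z
    using proj[OF that] by (simp add: inner_diff_right inner_axis)
  then obtain f where f: "\<And>e. e \<in> simplices (Suc 0) K \<Longrightarrow> (z\<^sub>0 - k *\<^sub>R axis \<sigma> 1) $ e = coboundary f $ e"
    by (rule orthogonal_cycles_1_potential[of K]) blast+
  have off: "z\<^sub>0 $ e = coboundary f $ e" if "e \<in> simplices (Suc 0) K" "e \<noteq> \<sigma>" for e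
    using f[OF that(1)] that(2) by (simp add: axis_def)
  have card2: "card e = 2" if "e \<in> simplices (Suc 0) K" for e
    using that by (simp add: simplices_def)
  have z\<^sub>0_chain: "z\<^sub>0 \<in> chains (Suc 0) K"
    using z\<^sub>0 by (simp add: cycles_def)
  have \<tau>K: "\<tau> \<in> simplices (Suc 0) K"
    using \<tau>(2) chains_nth_eq_0[OF z\<^sub>0_chain] by blast
  have f_\<tau>: "z\<^sub>0 $ \<tau> = f (Max \<tau>) - f (Min \<tau>)"
    using off[OF \<tau>K \<tau>(1)] card2[OF \<tau>K] by (simp add: coboundary_def)
  \<comment> \<open>Cut the graph at the higher end of \<open>\<tau>\<close>: away from \<open>\<sigma>\<close>, the flow \<open>z\<^sub>0\<close> crosses this cut only upwards.\<close>
  define g where "g v = (if f v \<ge> max (f (Max \<tau>)) (f (Min \<tau>)) then 1 else 0 :: real)" for v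
  define d where "d = coboundary g"
  have d_\<tau>: "\<bar>d $ \<tau>\<bar> = 1"
    using f_\<tau> \<tau>(2) card2[OF \<tau>K] by (auto simp: d_def coboundary_def g_def)
  have d_le: "\<bar>d $ e\<bar> \<le> 1" for e
    by (auto simp: d_def coboundary_def g_def)
  have sgn: "z\<^sub>0 $ e * d $ e = \<bar>z\<^sub>0 $ e\<bar> * \<bar>d $ e\<bar>" if "e \<noteq> \<sigma>" for e
  proof (cases "e \<in> simplices (Suc 0) K")
    case True
    then show ?thesis
      using off[OF True that] card2[OF True] by (auto simp: d_def coboundary_def g_def)
  next
    case False
    then show ?thesis
      using chains_nth_eq_0[OF z\<^sub>0_chain] by simp
  qed
  \<comment> \<open>Conservation of flow: a cycle is orthogonal to the coboundary of the cut, so its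
    flow through \<open>\<sigma>\<close> balances its flow through all other edges.\<close>
  have inner_d: "z $ \<sigma> * d $ \<sigma> + (\<Sum>e\<in>UNIV - {\<sigma>}. z $ e * d $ e) = 0" if "z \<in> cycles (Suc 0) K" for z
  proof -
    have "(\<Sum>e\<in>UNIV. z $ e * d $ e) = 0"
      using that by (simp add: mem_cycles_1_iff d_def inner_vec_def)
    then show ?thesis
      by (simp add: sum.remove[of UNIV \<sigma>])
  qed
  have rest: "z\<^sub>0 $ \<sigma> * d $ \<sigma> + (\<bar>z\<^sub>0 $ \<tau>\<bar> + (\<Sum>e\<in>UNIV - {\<sigma>} - {\<tau>}. \<bar>z\<^sub>0 $ e\<bar> * \<bar>d $ e\<bar>)) = 0"
    using inner_d[OF z\<^sub>0] \<tau>(1) by (simp add: sum.remove[of "UNIV - {\<sigma>}" \<tau>] sgn d_\<tau>)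
  have nonneg: "(\<Sum>e\<in>UNIV - {\<sigma>} - {\<tau>}. \<bar>z\<^sub>0 $ e\<bar> * \<bar>d $ e\<bar>) \<ge> 0"
    by (intro sum_nonneg) auto
  have le_\<sigma>: "\<bar>z\<^sub>0 $ \<sigma> * d $ \<sigma>\<bar> \<le> \<bar>z\<^sub>0 $ \<sigma>\<bar>"
    using d_le[of \<sigma>] by (simp add: abs_mult mult_left_le)
  have "\<bar>z $ \<tau>\<bar> = \<bar>z $ \<sigma>\<bar>" if eq: "\<bar>z\<^sub>0 $ \<tau>\<bar> = \<bar>z\<^sub>0 $ \<sigma>\<bar>" and z: "z \<in> cycles (Suc 0) K" for z
  proof -
    \<comment> \<open>In case of equality the balance \<open>rest\<close> is tight:
      \<open>\<sigma>\<close> must cross the cut, and the nonnegative sum over the remaining edges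
      must vanish.\<close>
    have "\<bar>z\<^sub>0 $ \<sigma>\<bar> \<le> \<bar>z\<^sub>0 $ \<sigma> * d $ \<sigma>\<bar>"
      using rest nonneg eq by linarith
    then have "\<bar>z\<^sub>0 $ \<sigma>\<bar> * 1 \<le> \<bar>z\<^sub>0 $ \<sigma>\<bar> * \<bar>d $ \<sigma>\<bar>"
      by (simp only: abs_mult mult_1_right)
    then have d_\<sigma>: "\<bar>d $ \<sigma>\<bar> = 1"
      using \<tau>(2) eq d_le[of \<sigma>] by (subst (asm) mult_le_cancel_left_pos) auto
    have "(\<Sum>e\<in>UNIV - {\<sigma>} - {\<tau>}. \<bar>z\<^sub>0 $ e\<bar> * \<bar>d $ e\<bar>) = 0"
      using rest nonneg le_\<sigma> eq by linarith
    then have zero: "z\<^sub>0 $ e = 0 \<or> d $ e = 0" if "e \<noteq> \<sigma>" "e \<noteq> \<tau>" for e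
      using that by (subst (asm) sum_nonneg_eq_0_iff) auto
    \<comment> \<open>The cut consists of \<open>\<sigma>\<close> and \<open>\<tau>\<close> alone, since \<open>z\<^sub>0\<close> is nonzero on every other edge of the cut.\<close>
    have "z $ e * d $ e = 0" if e: "e \<noteq> \<sigma>" "e \<noteq> \<tau>" for e
    proof (cases "e \<in> simplices (Suc 0) K")
      case True
      then show ?thesis
        using zero[OF e] off[OF True e(1)] card2[OF True] by (auto simp: d_def coboundary_def g_def)
    next
      case False
      then show ?thesis
        using z chains_nth_eq_0[of z] by (auto simp: cycles_def)
    qed
    then have "(\<Sum>e\<in>UNIV - {\<sigma>} - {\<tau>}. z $ e * d $ e) = 0"
      by (intro sum.neutral) auto
    then have "z $ \<sigma> * d $ \<sigma> + z $ \<tau> * d $ \<tau> = 0"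
      using inner_d[OF z] \<tau>(1) by (simp add: sum.remove[of "UNIV - {\<sigma>}" \<tau>])
    then have "\<bar>z $ \<sigma> * d $ \<sigma>\<bar> = \<bar>z $ \<tau> * d $ \<tau>\<bar>"
      by linarith
    then show ?thesis
      by (simp add: abs_mult d_\<sigma> d_\<tau>)
  qed
  moreover have "\<bar>z\<^sub>0 $ \<tau>\<bar> \<le> \<bar>z\<^sub>0 $ \<sigma>\<bar>"
    using rest nonneg le_\<sigma> by linarith
  ultimately show ?thesis
    by blast
qed

text \<open>In degree 0 every vertex of \<open>K\<close> is a cycle, and testing \<open>proj\<close>
  on \<open>\<tau>\<close> gives \<open>z\<^sub>0 $ \<tau> = 0\<close>. A zero coefficient makes the
  bound trivial and excludes equality, so only the cut argument in degree 1 remains.\<close>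

lemma cycles_projection_bound:
  assumes p: "p \<in> {0, 1}" and z\<^sub>0: "z\<^sub>0 \<in> cycles p K"
    and proj: "\<forall>z\<in>cycles p K. z \<bullet> z\<^sub>0 = k * z $ \<sigma>"
    and "\<tau> \<noteq> \<sigma>" "z\<^sub>0 $ \<sigma> \<noteq> 0"
  shows "\<bar>z\<^sub>0 $ \<tau>\<bar> \<le> \<bar>z\<^sub>0 $ \<sigma>\<bar>"
    and "\<bar>z\<^sub>0 $ \<tau>\<bar> = \<bar>z\<^sub>0 $ \<sigma>\<bar> \<Longrightarrow> z \<in> cycles p K \<Longrightarrow> \<bar>z $ \<tau>\<bar> = \<bar>z $ \<sigma>\<bar>"
proof -
  have "z\<^sub>0 $ \<tau> = 0" if "p = 0"
  proof (cases "\<tau> \<in> simplices p K")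
    case True
    then have "axis \<tau> 1 \<in> cycles p K"
      using that by (auto simp: cycles_def chains_def supp_def boundary_def axis_def)
    then show ?thesis
      using bspec[OF proj, of "axis \<tau> 1"] \<open>\<tau> \<noteq> \<sigma>\<close> by (simp add: inner_axis') (simp add: axis_def)
  next
    case False
    then show ?thesis
      using z\<^sub>0 chains_nth_eq_0[of z\<^sub>0 p K] by (auto simp: cycles_def)
  qed
  then have cases: "z\<^sub>0 $ \<tau> = 0 \<or> p = Suc 0 \<and> z\<^sub>0 $ \<tau> \<noteq> 0"
    using p by auto
  show "\<bar>z\<^sub>0 $ \<tau>\<bar> \<le> \<bar>z\<^sub>0 $ \<sigma>\<bar>"
    using cases cycles_1_projection_cut[of z\<^sub>0 K k \<sigma> \<tau>] z\<^sub>0 proj \<open>\<tau> \<noteq> \<sigma>\<close> by auto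
  show "\<bar>z $ \<tau>\<bar> = \<bar>z $ \<sigma>\<bar>" if "\<bar>z\<^sub>0 $ \<tau>\<bar> = \<bar>z\<^sub>0 $ \<sigma>\<bar>" "z \<in> cycles p K"
    using that cases cycles_1_projection_cut[of z\<^sub>0 K k \<sigma> \<tau>] z\<^sub>0 proj \<open>\<tau> \<noteq> \<sigma>\<close> \<open>z\<^sub>0 $ \<sigma> \<noteq> 0\<close> by auto
qed

section \<open>Persistence in terms of cycles\<close>

lemma homology_class_conv: "homology_class p K z = (\<lambda>b. b + z) ` boundaries p K"
  by (auto simp: homology_class_def a_r_coset_def' lin_space_def)

lemma homology_class_eq_iff: "homology_class p K x = homology_class p K y \<longleftrightarrow> x - y \<in> boundaries p K"
proof
  assume "homology_class p K x = homology_class p K y"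
  moreover have "x \<in> homology_class p K x"
    unfolding homology_class_conv using subspace_0[OF subspace_boundaries] by (intro image_eqI[of _ _ 0]) auto
  ultimately show "x - y \<in> boundaries p K"
    by (auto simp: homology_class_conv)
next
  have sub: "homology_class p K x \<subseteq> homology_class p K y" if "x - y \<in> boundaries p K" for x y
  proof
    fix a assume "a \<in> homology_class p K x"
    then obtain b where "b \<in> boundaries p K" "a = (b + (x - y)) + y"
      by (auto simp: homology_class_conv)
    then show "a \<in> homology_class p K y"
      unfolding homology_class_conv using subspace_add[OF subspace_boundaries _ that] by blast
  qed
  assume "x - y \<in> boundaries p K"
  moreover from this have "y - x \<in> boundaries p K"
    using subspace_neg[OF subspace_boundaries, of "x - y"] by simp
  ultimately show "homology_class p K x = homology_class p K y"
    by (intro equalityI sub)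
qed

text \<open>The union in \<open>induced_map\<close> collapses: elements of a class over
  \<open>K\<close> differ by boundaries of \<open>K\<close>, which are boundaries of
  \<open>L\<close>.\<close>

lemma induced_map_homology_class:
  assumes "boundaries p K \<subseteq> boundaries p L"
  shows "induced_map p L (homology_class p K z) = homology_class p L z"
proof -
  have "homology_class p L (b + z) = homology_class p L z" if "b \<in> boundaries p K" for b
    using that assms by (auto simp: homology_class_eq_iff)
  moreover have "boundaries p K \<noteq> {}"
    using subspace_0[OF subspace_boundaries, of p K] by blast
  ultimately show ?thesis
    by (simp add: induced_map_def homology_class_conv[of p K])
qed

lemma lin_param_homology:
  assumes "boundaries p K \<subseteq> cycles p K"
  shows "lin_param (homology p K) (cycles p K) (homology_class p K)"
  using lin_param_quotient[OF lin_param_lin_space[OF subspace_cycles] subspace_boundaries assms]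
  by (simp add: homology_def homology_class_def[abs_def])

lemma carrier_homology:
  "boundaries p K \<subseteq> cycles p K \<Longrightarrow> carrier (homology p K) = homology_class p K ` cycles p K"
  by (drule lin_param_homology) (simp add: lin_param_def)

locale filtered_complex =
  fixes p N :: nat and F :: "nat \<Rightarrow> 'v::{finite,linorder} set set"
  assumes filtration: "filtration N F" and p: "p \<in> {0, 1}"
begin

lemma F_mono: "s \<le> t \<Longrightarrow> t \<le> N \<Longrightarrow> F s \<subseteq> F t"
proof (induction rule: dec_induct)
  case (step n)
  then have "F n \<subseteq> F (Suc n)"
    using filtration by (simp add: filtration_def)
  then show ?case
    using step by auto
qed simp

lemma before_subset: "s \<le> t \<Longrightarrow> t \<le> N \<Longrightarrow> before F s \<subseteq> F t"
  using F_mono[of "s - 1" t] by (auto simp: before_def)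

lemma boundaries_F: "s \<le> N \<Longrightarrow> boundaries p (F s) \<subseteq> cycles p (F s)"
  using filtration p by (intro boundaries_subset_cycles) (auto simp: filtration_def)

lemma boundaries_before: "s \<le> N \<Longrightarrow> boundaries p (before F s) \<subseteq> cycles p (before F s)"
  using filtration p
  by (intro boundaries_subset_cycles) (auto simp: filtration_def before_def simplicial_complex_def)

text \<open>Classes agree over \<open>F t\<close> exactly when their representatives differ by a
  boundary of \<open>F t\<close>. This turns the condition on cosets into one on chains.\<close>

lemma mem_M_cycles_iff:
  assumes "s \<le> t" "t \<le> N"
  shows "z \<in> M_cycles p F s t \<longleftrightarrow>
    z \<in> cycles p (F s) \<and> (\<exists>y\<in>cycles p (before F s). z - y \<in> boundaries p (F t))"
proof -
  have "boundaries p (F s) \<subseteq> boundaries p (F t)" "boundaries p (before F s) \<subseteq> boundaries p (F t)"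
    using assms by (intro boundaries_mono F_mono before_subset; simp)+
  then have "z \<in> M_cycles p F s t \<longleftrightarrow> z \<in> cycles p (F s) \<and>
      homology_class p (F t) z \<in> homology_class p (F t) ` cycles p (before F s)"
    using assms
    by (auto simp: M_cycles_def M_sub_def carrier_homology boundaries_F boundaries_before
        induced_map_homology_class image_image)
  then show ?thesis
    by (simp add: image_iff homology_class_eq_iff)
qed

lemma M_cycles_subset: "M_cycles p F s t \<subseteq> cycles p (F s)"
  by (auto simp: M_cycles_def)

lemma M_sub_conv: "s \<le> N \<Longrightarrow> M_sub p F s t = homology_class p (F s) ` M_cycles p F s t"
  by (auto simp: M_cycles_def M_sub_def carrier_homology boundaries_F)

lemma subspace_M_cycles:
  assumes "s \<le> t" "t \<le> N"
  shows "subspace (M_cycles p F s t)"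
proof -
  have "M_cycles p F s t =
      cycles p (F s) \<inter> {y + b |y b. y \<in> cycles p (before F s) \<and> b \<in> boundaries p (F t)}"
  proof (intro equalityI subsetI)
    fix z assume "z \<in> M_cycles p F s t"
    then obtain y where "z \<in> cycles p (F s)" "y \<in> cycles p (before F s)" "z - y \<in> boundaries p (F t)"
      by (auto simp: mem_M_cycles_iff[OF assms])
    moreover have "z = y + (z - y)"
      by simp
    ultimately show "z \<in> cycles p (F s) \<inter> {y + b |y b. y \<in> cycles p (before F s) \<and> b \<in> boundaries p (F t)}"
      by blast
  qed (force simp: mem_M_cycles_iff[OF assms])
  then show ?thesis
    by (simp add: subspace_inter subspace_cycles subspace_sums subspace_boundaries)
qed

lemma M_cycles_mono:
  assumes "s \<le> t" "t \<le> u" "u \<le> N"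
  shows "M_cycles p F s t \<subseteq> M_cycles p F s u"
proof -
  have "boundaries p (F t) \<subseteq> boundaries p (F u)"
    using assms(2,3) by (intro boundaries_mono F_mono)
  then show ?thesis
    using assms by (force simp: mem_M_cycles_iff)
qed

text \<open>The index \<open>u - 1\<close> in \<open>P_space\<close> becomes \<open>t\<close>, so
  the multiplicity is the dimension of the quotient of these two subspaces.\<close>

lemma M_sub_step:
  assumes "s \<le> t" "Suc t \<le> N" and 0: "bar_mult p N F s (enat (Suc t)) = 0"
  shows "M_sub p F s (Suc t) = M_sub p F s t"
proof -
  let ?V = "homology p (F s)\<lparr>carrier := homology_class p (F s) ` M_cycles p F s (Suc t)\<rparr>"
  have s: "s \<le> N"
    using assms by simp
  have lin: "lin_param ?V (M_cycles p F s (Suc t)) (homology_class p (F s))"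
    using assms by (intro lin_param_restrict[OF lin_param_homology] boundaries_F subspace_M_cycles M_cycles_subset) auto
  have vdim: "vdim (quotient_space ?V (homology_class p (F s) ` M_cycles p F s t)) = 0"
    using 0 s by (simp add: bar_mult_def P_space_def M_sub_conv)
  have "carrier ?V = homology_class p (F s) ` M_cycles p F s t"
    using assms(1,2) by (intro vdim_quotient_eq_0[OF lin _ _ vdim] subspace_M_cycles M_cycles_mono) auto
  then show ?thesis
    using s by (simp add: M_sub_conv)
qed

lemma M_sub_infinity:
  assumes "s \<le> N" and 0: "bar_mult p N F s \<infinity> = 0"
  shows "M_sub p F s N = carrier (homology p (F s))"
proof -
  have "vdim (quotient_space (homology p (F s)) (homology_class p (F s) ` M_cycles p F s N)) = 0"
    using 0 assms by (simp add: bar_mult_def P_space_def M_sub_conv)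
  then show ?thesis
    using assms vdim_quotient_eq_0[OF lin_param_homology[OF boundaries_F] subspace_M_cycles M_cycles_subset]
    by (simp add: M_sub_conv)
qed

text \<open>The subspaces \<open>M_sub\<close> increase from time \<open>t\<close> up to
  \<open>N\<close> and then to the full homology of \<open>F s\<close>. Every successive quotient is
  a bar space after \<open>t\<close>, hence zero.\<close>

lemma M_cycles_eq_cycles:
  assumes "s \<le> t" "t \<le> N"
    and 0: "\<And>t'. t' \<in> end_times N \<Longrightarrow> enat t < t' \<Longrightarrow> bar_mult p N F s t' = 0"
  shows "M_cycles p F s t = cycles p (F s)"
proof -
  have "M_sub p F s t = M_sub p F s N"
    using assms(2)
  proof (induction rule: inc_induct)
    case (step n)
    have "bar_mult p N F s (enat (Suc n)) = 0"
      using step.hyps by (intro 0) (auto simp: end_times_def)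
    then show ?case
      using M_sub_step[of s n] step assms(1) by simp
  qed simp
  also have "\<dots> = carrier (homology p (F s))"
    using assms(1,2) by (intro M_sub_infinity 0) (auto simp: end_times_def)
  finally show ?thesis
    using assms(1,2) by (auto simp: M_cycles_def carrier_homology boundaries_F)
qed

end

section \<open>Harmonic chains and the representatives of a generic bar\<close>

lemma harmonic_map_cong:
  assumes "x - y \<in> boundaries p L"
  shows "harmonic_map p L x = harmonic_map p L y"
proof -
  \<comment> \<open>The projection onto the complement of the boundaries is described by a remainder
    in the double complement, that is, in the boundaries. The descriptions for \<open>x\<close> and
    \<open>y\<close> therefore coincide.\<close>
  have "x - u \<in> boundaries p L \<longleftrightarrow> y - u \<in> boundaries p L" for u
    using subspace_add[OF subspace_boundaries assms, of "y - u"]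
      subspace_diff[OF subspace_boundaries _ assms, of "x - u"] by auto
  then show ?thesis
    by (simp add: harmonic_map_def orthogonal_projection_def orthogonal_comp_self subspace_boundaries)
qed

text \<open>Splitting off the orthogonal projection onto the boundaries leaves a cycle, since
  boundaries are cycles.\<close>

lemma harmonic_decomposition:
  assumes "boundaries p K \<subseteq> cycles p K" "z \<in> cycles p K"
  obtains h where "h \<in> harmonic p K" "z - h \<in> boundaries p K"
proof -
  obtain b h where bh: "b \<in> span (boundaries p K)"
    "\<And>w. w \<in> span (boundaries p K) \<Longrightarrow> orthogonal h w" "z = b + h"
    using orthogonal_subspace_decomp_exists[of "boundaries p K" z] by metis
  have span_B: "span (boundaries p K) = boundaries p K"
    using subspace_boundaries span_eq_iff by blast
  have "h \<in> cycles p K"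
    using subspace_diff[OF subspace_cycles assms(2), of b] bh(1,3) assms(1) unfolding span_B by auto
  moreover have "h \<in> orthogonal_comp (boundaries p K)"
    using bh(2) unfolding span_B orthogonal_comp_def by (auto simp: orthogonal_commute)
  ultimately show thesis
    using bh(1,3) unfolding span_B by (intro that[of h]) (auto simp: harmonic_def)
qed

context filtered_complex
begin

text \<open>Orthogonality passes from harmonic chains to all of \<open>M_cycles\<close>: the
  harmonic part of \<open>w\<close> lies in \<open>harmonic_M\<close>, and the remainder is a
  boundary of \<open>F s\<close>, to which the harmonic chain \<open>z\<close> is
  orthogonal.\<close>

lemma orthogonal_M_cycles:
  assumes "s \<le> t" "t \<le> N" and z: "z \<in> harmonic p (F s)" "z \<in> orthogonal_comp (harmonic_M p F s t)"
    and w: "w \<in> M_cycles p F s t"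
  shows "w \<bullet> z = 0"
proof -
  have sN: "s \<le> N"
    using assms(1,2) by simp
  obtain y where y: "w \<in> cycles p (F s)" "y \<in> cycles p (before F s)" "w - y \<in> boundaries p (F t)"
    using w by (auto simp: mem_M_cycles_iff[OF assms(1,2)])
  obtain h where h: "h \<in> harmonic p (F s)" "w - h \<in> boundaries p (F s)"
    using boundaries_F[OF sN] y(1) by (rule harmonic_decomposition)
  obtain h' where h': "h' \<in> harmonic p (before F s)" "y - h' \<in> boundaries p (before F s)"
    using boundaries_before[OF sN] y(2) by (rule harmonic_decomposition)
  have wh: "w - h \<in> boundaries p (F t)"
    using h(2) boundaries_mono[OF F_mono[OF assms(1,2)]] by blast
  have yh': "y - h' \<in> boundaries p (F t)"
    using h'(2) boundaries_mono[OF before_subset[OF assms(1,2)]] by blast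
  \<comment> \<open>The combination telescopes to \<open>h - h'\<close>: over \<open>F t\<close>,
    the harmonic part of \<open>w\<close> is homologous to a harmonic cycle of the preceding
    complex.\<close>
  have "(w - y) + (y - h') - (w - h) \<in> boundaries p (F t)"
    by (rule subspace_diff[OF subspace_boundaries subspace_add[OF subspace_boundaries y(3) yh'] wh])
  then have "h - h' \<in> boundaries p (F t)"
    by simp
  then have "harmonic_map p (F t) h = harmonic_map p (F t) h'"
    by (rule harmonic_map_cong)
  then have "h \<in> harmonic_M p F s t"
    using h(1) h'(1) by (auto simp: harmonic_M_def)
  then have "h \<bullet> z = 0"
    using z(2) by (auto simp: orthogonal_comp_def orthogonal_def)
  moreover have "(w - h) \<bullet> z = 0"
    using z(1) h(2) by (auto simp: harmonic_def orthogonal_comp_def orthogonal_def)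
  ultimately show ?thesis
    by (simp add: inner_diff_left)
qed

lemma generic_bar_representatives:
  assumes "(s, t, 1) \<in> barcode p N F" "generic_bar p N F s t" "harmonic_representative p N F s t z\<^sub>0"
  obtains W where "representatives p N F s t = cycles p (F s) - W"
    and "\<forall>w\<in>W. w \<bullet> z\<^sub>0 = 0" and "z\<^sub>0 \<in> cycles p (F s)" and "z\<^sub>0 \<noteq> 0"
proof -
  have bar: "s \<le> N" "t \<in> end_times N" "enat s < t"
    using assms(1) by (auto simp: barcode_def)
  have gen: "bar_mult p N F s t' = 0" if "t' \<in> end_times N" "enat s < t'" "t' \<noteq> t" for t'
    using assms(2) that by (simp add: generic_bar_def)
  have z\<^sub>0: "z\<^sub>0 \<in> harmonic_P p N F s t" "z\<^sub>0 \<noteq> 0"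
    using assms(3) by (auto simp: harmonic_representative_def)
  \<comment> \<open>One index covers both kinds of bars: the time just before a finite death, or
    \<open>N\<close> for an infinite bar. At a finite death time genericity makes
    \<open>M_cycles\<close> all of the cycles, so the set difference starts from
    \<open>cycles p (F s)\<close> in both cases.\<close>
  have "\<exists>u. s \<le> u \<and> u \<le> N \<and> representatives p N F s t = cycles p (F s) - M_cycles p F s u \<and>
      z\<^sub>0 \<in> harmonic p (F s) \<and> z\<^sub>0 \<in> orthogonal_comp (harmonic_M p F s u)"
  proof (cases t)
    case (enat u)
    then have u: "s < u" "u \<le> N"
      using bar by (auto simp: end_times_def)
    have "M_cycles p F s u = cycles p (F s)"
    proof (rule M_cycles_eq_cycles)
      fix t' assume t': "t' \<in> end_times N" "enat u < t'"
      have "enat s < enat u"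
        using u by simp
      then show "bar_mult p N F s t' = 0"
        using t' enat by (intro gen less_trans[of "enat s" "enat u" t']) auto
    qed (use u in auto)
    then show ?thesis
      using u z\<^sub>0 enat
      by (intro exI[of _ "u - 1"]) (auto simp: representatives_def harmonic_P_def harmonic_M_def)
  next
    case infinity
    then show ?thesis
      using bar z\<^sub>0 by (intro exI[of _ N]) (auto simp: representatives_def harmonic_P_def)
  qed
  then obtain u where u: "s \<le> u" "u \<le> N" "representatives p N F s t = cycles p (F s) - M_cycles p F s u"
    "z\<^sub>0 \<in> harmonic p (F s)" "z\<^sub>0 \<in> orthogonal_comp (harmonic_M p F s u)"
    by blast
  then show thesis
    using that[OF u(3)] orthogonal_M_cycles[OF u(1,2,4,5)] z\<^sub>0(2) by (auto simp: harmonic_def)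
qed

end

text \<open>A suitable multiple of \<open>z\<^sub>0\<close> cancels the coefficient of any cycle at
  \<open>\<sigma>\<close>. What remains must lie in \<open>W\<close>, hence is orthogonal to
  \<open>z\<^sub>0\<close>. The chain \<open>z\<^sub>0\<close> itself is outside \<open>W\<close>,
  being nonzero and so not orthogonal to itself.\<close>

lemma essential_coordinate:
  fixes z\<^sub>0 :: "'v::{finite,linorder} chain"
  assumes W: "\<forall>w\<in>W. w \<bullet> z\<^sub>0 = 0" and z\<^sub>0: "z\<^sub>0 \<in> cycles p K" "z\<^sub>0 \<noteq> 0"
    and \<sigma>: "\<forall>z\<in>cycles p K - W. z $ \<sigma> \<noteq> 0"
  shows "z\<^sub>0 $ \<sigma> \<noteq> 0" and "\<forall>z\<in>cycles p K. z \<bullet> z\<^sub>0 = (z\<^sub>0 \<bullet> z\<^sub>0 / z\<^sub>0 $ \<sigma>) * z $ \<sigma>"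
proof -
  have "z\<^sub>0 \<notin> W"
    using W z\<^sub>0(2) by auto
  then show nz: "z\<^sub>0 $ \<sigma> \<noteq> 0"
    using \<sigma> z\<^sub>0(1) by blast
  show "\<forall>z\<in>cycles p K. z \<bullet> z\<^sub>0 = (z\<^sub>0 \<bullet> z\<^sub>0 / z\<^sub>0 $ \<sigma>) * z $ \<sigma>"
  proof
    fix z assume z: "z \<in> cycles p K"
    let ?y = "z - (z $ \<sigma> / z\<^sub>0 $ \<sigma>) *\<^sub>R z\<^sub>0"
    have "?y \<in> cycles p K"
      using subspace_cycles z z\<^sub>0(1) by (intro subspace_diff subspace_scale)
    moreover have "?y $ \<sigma> = 0"
      using nz by simp
    ultimately have "?y \<in> W"
      using \<sigma> by blast
    then have "?y \<bullet> z\<^sub>0 = 0"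
      using W by blast
    then show "z \<bullet> z\<^sub>0 = (z\<^sub>0 \<bullet> z\<^sub>0 / z\<^sub>0 $ \<sigma>) * z $ \<sigma>"
      by (simp add: inner_diff_left)
  qed
qed

theorem theorem1:
  fixes F :: "nat \<Rightarrow> 'v::{finite,linorder} set set"
    and N p s :: nat and t :: enat and z\<^sub>0 :: "real ^ 'v set"
  assumes "filtration N F"
    and "p \<in> {0, 1}"
    and "(s, t, 1) \<in> barcode p N F"
    and "generic_bar p N F s t"
    and "harmonic_representative p N F s t z\<^sub>0"
  shows "\<forall>\<sigma>\<in>essential_simplices p N F s t. \<forall>\<tau>\<in>simplices p (F N). \<tau> \<noteq> \<sigma> \<longrightarrow>
           \<bar>z\<^sub>0 $ \<tau>\<bar> \<le> \<bar>z\<^sub>0 $ \<sigma>\<bar> \<and>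
           (\<bar>z\<^sub>0 $ \<tau>\<bar> = \<bar>z\<^sub>0 $ \<sigma>\<bar> \<longleftrightarrow> \<tau> \<in> essential_simplices p N F s t)"
proof -
  interpret filtered_complex p N F
    using assms(1,2) by unfold_locales
  obtain W where rep: "representatives p N F s t = cycles p (F s) - W"
    and W: "\<forall>w\<in>W. w \<bullet> z\<^sub>0 = 0" and z\<^sub>0: "z\<^sub>0 \<in> cycles p (F s)" "z\<^sub>0 \<noteq> 0"
    using assms(3-5) by (rule generic_bar_representatives)
  have essential: "\<sigma> \<in> essential_simplices p N F s t \<longleftrightarrow> (\<forall>z\<in>cycles p (F s) - W. z $ \<sigma> \<noteq> 0)" for \<sigma>
    by (simp add: essential_simplices_def rep supp_def)
  note coordinate = essential_coordinate[OF W z\<^sub>0]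
  note bound = cycles_projection_bound[OF assms(2) z\<^sub>0(1)]
  show ?thesis
  proof (intro ballI impI conjI iffI)
    fix \<sigma> \<tau> assume \<sigma>: "\<sigma> \<in> essential_simplices p N F s t" and \<tau>: "\<tau> \<noteq> \<sigma>"
    have \<sigma>': "\<forall>z\<in>cycles p (F s) - W. z $ \<sigma> \<noteq> 0"
      using \<sigma> by (simp add: essential)
    note bound_\<sigma> = bound[OF coordinate(2)[OF \<sigma>'] \<tau> coordinate(1)[OF \<sigma>']]
    show le: "\<bar>z\<^sub>0 $ \<tau>\<bar> \<le> \<bar>z\<^sub>0 $ \<sigma>\<bar>"
      by (rule bound_\<sigma>(1))
    \<comment> \<open>Every cycle now has coefficients of equal size at \<open>\<sigma>\<close> and
      \<open>\<tau>\<close>, so no representative vanishes at \<open>\<tau>\<close>.\<close>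
    show "\<tau> \<in> essential_simplices p N F s t" if "\<bar>z\<^sub>0 $ \<tau>\<bar> = \<bar>z\<^sub>0 $ \<sigma>\<bar>"
      unfolding essential using bound_\<sigma>(2)[OF that] \<sigma>' by fastforce
    assume "\<tau> \<in> essential_simplices p N F s t"
    then have \<tau>': "\<forall>z\<in>cycles p (F s) - W. z $ \<tau> \<noteq> 0"
      by (simp add: essential)
    \<comment> \<open>The same bound with the roles of \<open>\<sigma>\<close> and
      \<open>\<tau>\<close> exchanged.\<close>
    have "\<bar>z\<^sub>0 $ \<sigma>\<bar> \<le> \<bar>z\<^sub>0 $ \<tau>\<bar>"
      by (rule bound(1)[OF coordinate(2)[OF \<tau>'] \<tau>[symmetric] coordinate(1)[OF \<tau>']])
    then show "\<bar>z\<^sub>0 $ \<tau>\<bar> = \<bar>z\<^sub>0 $ \<sigma>\<bar>"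
      using le by simp
  qed
qed

end
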